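(* Let $q>1$ and let $M^q=(M^q_p)_{p\in\mathbb{N}}$ with $M^q_p:=q^{p^2}$. Then every strictly increasing sequence of nonnegative integers $(a_j)_{j\ge1}$ satisfying $$\sup_{j\ge1}(a_{j+1}-a_j)<+\infty\qquad\text{and}\qquad(a_{j+1}-a_j)(a_{j+1}-a_j-1)>\frac{\log 2}{\log q}\quad\text{for all } j\ge1$$ is a sequence of Lusky numbers for $M^q$.
   Context: $\mathbb{N}=\{0,1,2,\dots\}$. For a sequence $M=(M_p)_{p\in\mathbb{N}}$ of positive reals put $\mu_p:=M_p/M_{p-1}$ for $p\ge1$ and $\mu_0:=1$. For integers $0\le k<l$, $$A_M(k,l):=\frac{(\mu_{l+1})^{l-k}}{\mu_{k+1}\cdots\mu_l},\qquad B_M(k,l):=\frac{\mu_{k+1}\cdots\mu_l}{(\mu_{k+1})^{l-k}}.$$ A strictly increasing sequence of nonnegative integers $(a_j)_{j\ge1}$ is called a sequence of Lusky numbers for $M$ if there exist constants $K\ge b>2$ such that for all $j\ge1$: $b\le\min\{A_M(a_j,a_{j+1}),B_M(a_j,a_{j+1})\}\le\max\{A_M(a_j,a_{j+1}),B_M(a_j,a_{j+1})\}\le K$. *)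

theory Defs
  imports Complex_Main
begin

definition quot_seq :: "(nat \<Rightarrow> real) \<Rightarrow> nat \<Rightarrow> real" where
  "quot_seq M p = (if p = 0 then 1 else M p / M (p - 1))"

(* A_quot and B_quot are only meant for k < l; outside this range the truncated exponent
   l - k and the empty product both make them 1. *)

definition A_quot :: "(nat \<Rightarrow> real) \<Rightarrow> nat \<Rightarrow> nat \<Rightarrow> real" where
  "A_quot M k l = quot_seq M (l + 1) ^ (l - k) / (\<Prod>i = k + 1..l. quot_seq M i)"

definition B_quot :: "(nat \<Rightarrow> real) \<Rightarrow> nat \<Rightarrow> nat \<Rightarrow> real" where
  "B_quot M k l = (\<Prod>i = k + 1..l. quot_seq M i) / quot_seq M (k + 1) ^ (l - k)"

(* Sequences (a_j) with j >= 1 are functions on nat of which only the restriction to {1..}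
   matters; the value a 0 is unconstrained. *)

definition lusky_numbers :: "(nat \<Rightarrow> real) \<Rightarrow> (nat \<Rightarrow> nat) \<Rightarrow> bool" where
  "lusky_numbers M a \<longleftrightarrow>
     strict_mono_on {1..} a \<and>
     (\<exists>K b :: real. K \<ge> b \<and> b > 2 \<and>
       (\<forall>j\<ge>1. b \<le> min (A_quot M (a j) (a (j + 1))) (B_quot M (a j) (a (j + 1))) \<and>
               max (A_quot M (a j) (a (j + 1))) (B_quot M (a j) (a (j + 1))) \<le> K))"

definition q_gevrey :: "real \<Rightarrow> nat \<Rightarrow> real" where
  "q_gevrey q p = q ^ (p\<^sup>2)"

end

theory Submission
  imports Defs
begin

text \<open>
  For \<open>M p = q ^ (p\<^sup>2)\<close> the quotients are \<open>\<mu> p = q ^ (2 * p - 1)\<close> for \<open>p \<ge> 1\<close>, and their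
  logarithms to base \<open>q\<close> form an arithmetic progression. Both \<open>A(k, l)\<close> and \<open>B(k, l)\<close> compare
  a block of such quotients with a power of a boundary quotient, so the contribution of \<open>k\<close>
  cancels and only the gap \<open>d = l - k\<close> survives:
  \<open>A(k, k + d) = q ^ (d * (d + 1))\<close> and \<open>B(k, k + d) = q ^ (d * (d - 1))\<close>.
  Hence \<open>B \<le> A\<close>; bounded gaps give the upper bound \<open>K\<close>, and the condition on
  \<open>d * (d - 1)\<close> says exactly that every \<open>B\<close> exceeds \<open>2\<close>. A lower bound that is uniformly larger
  than \<open>2\<close> exists because the exponents \<open>d * (d - 1)\<close> are integers: they are all at least the
  least integer above \<open>ln 2 / ln q\<close>.
\<close>

lemma quot_seq_q_gevrey_Suc:
  assumes "q > 0"
  shows "quot_seq (q_gevrey q) (Suc p) = q ^ (2 * p + 1)"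
proof -
  have "(Suc p)\<^sup>2 = p\<^sup>2 + (2 * p + 1)"
    by (simp add: power2_eq_square)
  then have "q_gevrey q (Suc p) = q_gevrey q p * q ^ (2 * p + 1)"
    unfolding q_gevrey_def by (simp only: power_add)
  moreover have "q_gevrey q p \<noteq> 0"
    using assms by (simp add: q_gevrey_def)
  ultimately show ?thesis
    by (simp add: quot_seq_def)
qed

text \<open>
  The product telescopes to \<open>M (k + d) / M k\<close>; the exponent is \<open>(k + d)\<^sup>2 - k\<^sup>2\<close>, written without
  subtraction.
\<close>

lemma prod_quot_seq_q_gevrey:
  assumes "q > 0"
  shows "(\<Prod>i = k + 1..k + d. quot_seq (q_gevrey q) i) = q ^ (d * (2 * k + d))"
proof (induction d)
  case 0
  show ?case by simp
next
  case (Suc d)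
  have "Suc d * (2 * k + Suc d) = d * (2 * k + d) + (2 * (k + d) + 1)"
    by (simp add: algebra_simps)
  then show ?case
    using Suc.IH by (simp add: quot_seq_q_gevrey_Suc[OF assms] power_add)
qed

lemma A_quot_q_gevrey:
  assumes "q > 0"
  shows "A_quot (q_gevrey q) k (k + d) = q ^ (d * (d + 1))"
proof -
  have "(2 * (k + d) + 1) * d = d * (d + 1) + d * (2 * k + d)"
    by (simp add: algebra_simps)
  then have "quot_seq (q_gevrey q) (k + d + 1) ^ d = q ^ (d * (d + 1)) * q ^ (d * (2 * k + d))"
    by (metis Suc_eq_plus1 power_add power_mult quot_seq_q_gevrey_Suc[OF assms])
  then show ?thesis
    using assms unfolding A_quot_def prod_quot_seq_q_gevrey[OF assms] by simp
qed

lemma B_quot_q_gevrey: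
  assumes "q > 0"
  shows "B_quot (q_gevrey q) k (k + d) = q ^ (d * (d - 1))"
proof -
  have "d * (2 * k + d) = d * (d - 1) + (2 * k + 1) * d"
    by (cases d) (simp_all add: algebra_simps)
  then have "q ^ (d * (2 * k + d)) = q ^ (d * (d - 1)) * quot_seq (q_gevrey q) (k + 1) ^ d"
    by (metis Suc_eq_plus1 power_add power_mult quot_seq_q_gevrey_Suc[OF assms])
  moreover have "quot_seq (q_gevrey q) (k + 1) \<noteq> 0"
    using quot_seq_q_gevrey_Suc[OF assms, of k] assms by simp
  ultimately show ?thesis
    unfolding B_quot_def prod_quot_seq_q_gevrey[OF assms] by simp
qed

theorem proposition4p14:
  fixes q :: real and a :: "nat \<Rightarrow> nat"
  assumes "q > 1"
    and "strict_mono_on {1..} a"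
    and "bdd_above ((\<lambda>j. real (a (j + 1)) - real (a j)) ` {1..})"
    and "\<And>j. j \<ge> 1 \<Longrightarrow>
           (real (a (j + 1)) - real (a j)) * (real (a (j + 1)) - real (a j) - 1) > ln 2 / ln q"
  shows "lusky_numbers (q_gevrey q) a"
proof -
  define d where "d j = a (j + 1) - a j" for j
  have less: "a j < a (j + 1)" if "j \<ge> 1" for j
    using assms(2) that by (auto simp: strict_mono_on_def)
  have a_Suc: "a (j + 1) = a j + d j" and d_pos: "d j \<ge> 1" if "j \<ge> 1" for j
    using less[OF that] by (simp_all add: d_def)

  have "\<exists>C. \<forall>j\<ge>1. real (a (j + 1)) - real (a j) \<le> C"
    using assms(3) by (auto simp: bdd_above_def)
  then obtain C where "real (a (j + 1)) - real (a j) \<le> C" if "j \<ge> 1" for j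
    by blast
  then have "real (d j) \<le> C" if "j \<ge> 1" for j
    using a_Suc[OF that] that by fastforce
  then have d_le: "d j \<le> nat \<lfloor>C\<rfloor>" if "j \<ge> 1" for j
    using that by (simp add: le_nat_floor)

  define m where "m = (LEAST n::nat. ln 2 / ln q < real n)"
  have "ln 2 / ln q < real m"
    unfolding m_def by (rule LeastI_ex) (rule reals_Archimedean2)
  then have "ln 2 < ln (q ^ m)"
    using assms(1) by (simp add: divide_less_eq ln_realpow)
  then have two_less: "2 < q ^ m"
    using assms(1) by simp
  have m_le: "m \<le> d j * (d j - 1)" if "j \<ge> 1" for j
  proof -
    have "real (d j * (d j - 1)) = real (d j) * (real (d j) - 1)"
      using d_pos[OF that] by (simp add: of_nat_diff)
    moreover have "real (a (j + 1)) - real (a j) = real (d j)"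
      using a_Suc[OF that] by simp
    ultimately have "ln 2 / ln q < real (d j * (d j - 1))"
      using assms(4)[OF that] by metis
    then show ?thesis
      unfolding m_def by (rule Least_le)
  qed

  define K where "K = q ^ (nat \<lfloor>C\<rfloor> * (nat \<lfloor>C\<rfloor> + 1))"
  have bounds: "q ^ m \<le> B_quot (q_gevrey q) (a j) (a (j + 1)) \<and>
      B_quot (q_gevrey q) (a j) (a (j + 1)) \<le> A_quot (q_gevrey q) (a j) (a (j + 1)) \<and>
      A_quot (q_gevrey q) (a j) (a (j + 1)) \<le> K" if "j \<ge> 1" for j
  proof -
    have "q ^ (d j * (d j - 1)) \<le> q ^ (d j * (d j + 1))"
      using assms(1) by (intro power_increasing mult_le_mono) auto
    moreover have "q ^ (d j * (d j + 1)) \<le> K"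
      unfolding K_def using assms(1) d_le[OF that] by (intro power_increasing mult_le_mono) auto
    moreover have "q ^ m \<le> q ^ (d j * (d j - 1))"
      using assms(1) m_le[OF that] by (intro power_increasing) auto
    ultimately show ?thesis
      unfolding a_Suc[OF that] using assms(1) by (simp only: A_quot_q_gevrey B_quot_q_gevrey)
  qed
  have "q ^ m \<le> K"
    using bounds[OF order_refl] by linarith
  moreover have "\<forall>j\<ge>1. q ^ m \<le> min (A_quot (q_gevrey q) (a j) (a (j + 1)))
                                  (B_quot (q_gevrey q) (a j) (a (j + 1))) \<and>
                     max (A_quot (q_gevrey q) (a j) (a (j + 1)))
                         (B_quot (q_gevrey q) (a j) (a (j + 1))) \<le> K"
    using bounds by fastforce
  ultimately show ?thesis
    unfolding lusky_numbers_def using assms(2) two_less by blast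
qed

end
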